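(* The Thompson group $\mathbb{F}$ and the free group on finitely many generators can be equipped with a compatible semiorder which is not a weak order.
   Context: The Thompson group $\mathbb{F}$ is the group (under composition) of orientation-preserving piecewise linear homeomorphisms of $[0,1]$ with finitely many breakpoints, all at dyadic rationals, and with all slopes integer powers of $2$. A partial order on a group is compatible if it is preserved by all left and right translations. For positive integers $r,s$, $r\oplus s$ is the disjoint union of an $r$-element chain and an $s$-element chain with no comparabilities between them; an embedding of posets is a one-to-one map $f$ with $f(x)\leq f(y)$ iff $x\leq y$. An order is a semiorder if it embeds neither $2\oplus 2$ nor $3\oplus 1$; it is a weak order if it does not embed $1\oplus 2$. *)

theory Defs
  imports "HOL-Analysis.Analysis" "HOL-Algebra.Bij"
begin

subsection \<open>Posets, semiorders and weak orders\<close>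

definition poset_embedding ::
    "'a set \<Rightarrow> 'a rel \<Rightarrow> 'b set \<Rightarrow> 'b rel \<Rightarrow> ('a \<Rightarrow> 'b) \<Rightarrow> bool" where
  "poset_embedding A R B S f \<longleftrightarrow>
     f \<in> A \<rightarrow> B \<and> inj_on f A \<and> (\<forall>x\<in>A. \<forall>y\<in>A. (f x, f y) \<in> S \<longleftrightarrow> (x, y) \<in> R)"

definition poset_embeds :: "'a set \<Rightarrow> 'a rel \<Rightarrow> 'b set \<Rightarrow> 'b rel \<Rightarrow> bool" where
  "poset_embeds A R B S \<longleftrightarrow> (\<exists>f. poset_embedding A R B S f)"

definition chains_carrier :: "nat \<Rightarrow> nat \<Rightarrow> (nat + nat) set" where
  "chains_carrier r s = {..<r} <+> {..<s}"

definition chains_order :: "nat \<Rightarrow> nat \<Rightarrow> (nat + nat) rel" where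
  "chains_order r s =
     {(Inl i, Inl j) | i j. i \<le> j \<and> j < r} \<union> {(Inr i, Inr j) | i j. i \<le> j \<and> j < s}"

definition embeds_chains :: "nat \<Rightarrow> nat \<Rightarrow> 'a set \<Rightarrow> 'a rel \<Rightarrow> bool" where
  "embeds_chains r s A R \<longleftrightarrow> poset_embeds (chains_carrier r s) (chains_order r s) A R"

definition semiorder_on :: "'a set \<Rightarrow> 'a rel \<Rightarrow> bool" where
  "semiorder_on A R \<longleftrightarrow>
     partial_order_on A R \<and> \<not> embeds_chains 2 2 A R \<and> \<not> embeds_chains 3 1 A R"

definition weak_order_on :: "'a set \<Rightarrow> 'a rel \<Rightarrow> bool" where
  "weak_order_on A R \<longleftrightarrow> partial_order_on A R \<and> \<not> embeds_chains 1 2 A R"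

definition compatible_order :: "('a, 'b) monoid_scheme \<Rightarrow> 'a rel \<Rightarrow> bool" where
  "compatible_order G R \<longleftrightarrow>
     partial_order_on (carrier G) R \<and>
     (\<forall>x y z. (x, y) \<in> R \<longrightarrow> z \<in> carrier G \<longrightarrow>
        (z \<otimes>\<^bsub>G\<^esub> x, z \<otimes>\<^bsub>G\<^esub> y) \<in> R \<and> (x \<otimes>\<^bsub>G\<^esub> z, y \<otimes>\<^bsub>G\<^esub> z) \<in> R)"


subsection \<open>The Thompson group\<close>

text \<open>
  \<^term>\<open>B\<close> contains all breakpoints of \<^term>\<open>f\<close> (it may contain further dyadic points). The set
  \<^term>\<open>dyadics\<close> of the library consists of the nonnegative dyadic rationals only, which is no
  restriction inside the unit interval.
\<close>

definition dyadic_piecewise_linear :: "(real \<Rightarrow> real) \<Rightarrow> bool" where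
  "dyadic_piecewise_linear f \<longleftrightarrow>
     (\<exists>B. finite B \<and> B \<subseteq> dyadics \<inter> {0..1} \<and>
        (\<forall>a b. 0 \<le> a \<longrightarrow> a < b \<longrightarrow> b \<le> 1 \<longrightarrow> {a<..<b} \<inter> B = {} \<longrightarrow>
           (\<exists>(k::int) (c::real). \<forall>x\<in>{a..b}. f x = 2 powi k * x + c)))"

text \<open>
  As in \<^const>\<open>BijGroup\<close>, homeomorphisms of the unit interval are represented by functions
  that are \<^const>\<open>undefined\<close> outside it.
\<close>

definition thompson_carrier :: "(real \<Rightarrow> real) set" where
  "thompson_carrier =
     {f \<in> Bij {0..1}. (\<exists>g. homeomorphism {0..1} {0..1} f g) \<and> strict_mono_on {0..1} f \<and>
        dyadic_piecewise_linear f}"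

definition thompson_group :: "(real \<Rightarrow> real) monoid" where
  "thompson_group = (BijGroup {0..1}) \<lparr>carrier := thompson_carrier\<rparr>"

lemma real_dyadics_iff:
  fixes x :: real
  assumes "0 \<le> x"
  shows "x \<in> dyadics \<longleftrightarrow> (\<exists>n::nat. x * 2 ^ n \<in> \<int>)"
proof
  assume "x \<in> dyadics"
  then obtain m n :: nat where "x = of_nat m / 2 ^ n"
    by (auto simp: dyadics_def)
  then have "x * 2 ^ n \<in> \<int>"
    by simp
  then show "\<exists>n::nat. x * 2 ^ n \<in> \<int>" ..
next
  assume "\<exists>n::nat. x * 2 ^ n \<in> \<int>"
  then obtain n :: nat and i :: int where i: "x * 2 ^ n = of_int i"
    by (auto elim: Ints_cases)
  have "0 \<le> x * 2 ^ n"
    using assms by simp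
  then have "0 \<le> i"
    using i by simp
  then have "x = of_nat (nat i) / 2 ^ n"
    using i by (simp add: field_simps)
  then show "x \<in> dyadics"
    unfolding dyadics_def by blast
qed

lemma dyadic_affine_imp:
  fixes x y c :: real and k :: int
  assumes "\<exists>n::nat. c * 2 ^ n \<in> \<int>" "\<exists>n::nat. x * 2 ^ n \<in> \<int>"
  shows "\<exists>n::nat. (2 powi k * x + c) * 2 ^ n \<in> \<int>"
proof -
  from assms obtain m n :: nat where mn: "c * 2 ^ m \<in> \<int>" "x * 2 ^ n \<in> \<int>"
    by blast
  have "2 powi k * (2::real) ^ nat \<bar>k\<bar> \<in> \<int>"
  proof (cases "0 \<le> k")
    case True
    then show ?thesis by (simp add: power_int_def)
  next
    case False
    then show ?thesis by (simp add: power_int_def field_simps)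
  qed
  then have "(2 powi k * (2::real) ^ nat \<bar>k\<bar>) * (x * 2 ^ n) * 2 ^ m
      + (c * 2 ^ m) * 2 ^ n * 2 ^ nat \<bar>k\<bar> \<in> \<int>"
    by (rule Ints_add[OF Ints_mult[OF Ints_mult[OF _ mn(2)]] Ints_mult[OF Ints_mult[OF mn(1)]]])
      simp_all
  also have "(2 powi k * (2::real) ^ nat \<bar>k\<bar>) * (x * 2 ^ n) * 2 ^ m
      + (c * 2 ^ m) * 2 ^ n * 2 ^ nat \<bar>k\<bar>
      = (2 powi k * x + c) * 2 ^ (nat \<bar>k\<bar> + n + m)"
    by (simp add: power_add algebra_simps)
  finally show ?thesis ..
qed

lemma dyadic_affine_iff:
  fixes x c :: real and k :: int
  assumes "\<exists>n::nat. c * 2 ^ n \<in> \<int>"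
  shows "(\<exists>n::nat. (2 powi k * x + c) * 2 ^ n \<in> \<int>) \<longleftrightarrow> (\<exists>n::nat. x * 2 ^ n \<in> \<int>)"
proof
  assume L: "\<exists>n::nat. (2 powi k * x + c) * 2 ^ n \<in> \<int>"
  from assms obtain m :: nat where "c * 2 ^ m \<in> \<int>" ..
  then have "- (c * 2 ^ m) \<in> \<int>"
    by (rule Ints_minus)
  then have "\<exists>n::nat. (- c) * 2 ^ n \<in> \<int>"
    by (auto intro!: exI[of _ m])
  then have "\<exists>n::nat. (2 powi 0 * (2 powi k * x + c) + - c) * 2 ^ n \<in> \<int>"
    using L by (rule dyadic_affine_imp)
  moreover have "2 powi 0 * (2 powi k * x + c) + - c = 2 powi k * x"
    by simp
  ultimately have x2: "\<exists>n::nat. (2 powi k * x) * 2 ^ n \<in> \<int>"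
    by metis
  have "\<exists>n::nat. (0::real) * 2 ^ n \<in> \<int>"
    by simp
  from this x2 have "\<exists>n::nat. (2 powi (- k) * (2 powi k * x) + 0) * 2 ^ n \<in> \<int>"
    by (rule dyadic_affine_imp)
  moreover have "2 powi (- k) * (2 powi k * x) + 0 = x"
    by (simp add: power_int_minus)
  ultimately show "\<exists>n::nat. x * 2 ^ n \<in> \<int>"
    by metis
qed (rule dyadic_affine_imp[OF assms])

lemma thompson_carrierD:
  assumes "f \<in> thompson_carrier"
  shows "f \<in> extensional {0..1}" "bij_betw f {0..1} {0..1}" "f ` {0..1} = {0..1}"
    "continuous_on {0..1} f" "strict_mono_on {0..1} f" "f 0 = 0" "f 1 = 1"
proof -
  show 1: "f \<in> extensional {0..1}" "bij_betw f {0..1} {0..1}" "continuous_on {0..1} f"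
    and mono: "strict_mono_on {0..1} f"
    using assms by (auto simp: thompson_carrier_def Bij_def homeomorphism_def)
  then show im: "f ` {0..1} = {0..1}"
    by (simp add: bij_betw_def)
  then obtain u v where uv: "u \<in> {0..1}" "f u = 0" "v \<in> {0..1}" "f v = 1"
  proof -
    have "0 \<in> f ` {0..1}" "1 \<in> f ` {0..1}"
      by (simp_all add: im)
    then show ?thesis
      using that by (elim imageE) simp
  qed
  have mono': "f x \<le> f y" if "x \<in> {0..1}" "y \<in> {0..1}" "x \<le> y" for x y
    using mono that by (rule strict_mono_on_leD)
  have "f 0 \<le> f u" "f v \<le> f 1"
    using uv mono'[of 0 u] mono'[of v 1] by auto
  moreover have "f 0 \<in> {0..1}" "f 1 \<in> {0..1}"
    using im by (metis atLeastAtMost_iff imageI order_refl zero_le_one)+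
  ultimately show "f 0 = 0" "f 1 = 1"
    using uv by auto
qed

lemma thompson_carrierI:
  assumes "f \<in> extensional {0..1}" "bij_betw f {0..1} {0..1}"
    "continuous_on {0..1} f" "strict_mono_on {0..1} f" "dyadic_piecewise_linear f"
  shows "f \<in> thompson_carrier"
proof -
  have "\<exists>g. homeomorphism {0..1} {0..1} f g"
    using assms by (intro homeomorphism_compact) (auto simp: bij_betw_def)
  then show ?thesis
    using assms by (auto simp: thompson_carrier_def Bij_def)
qed

lemma thompson_dyadics_iff:
  assumes f: "f \<in> thompson_carrier" and x: "x \<in> {0..1}"
  shows "f x \<in> dyadics \<longleftrightarrow> x \<in> dyadics"
proof -
  note D = thompson_carrierD[OF f]
  have "dyadic_piecewise_linear f"
    using f by (simp add: thompson_carrier_def)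
  then obtain B where B: "finite B" "B \<subseteq> dyadics \<inter> {0..1}"
    and lin: "\<And>a b. 0 \<le> a \<Longrightarrow> a < b \<Longrightarrow> b \<le> 1 \<Longrightarrow> {a<..<b} \<inter> B = {} \<Longrightarrow>
       \<exists>(k::int) (c::real). \<forall>x\<in>{a..b}. f x = 2 powi k * x + c"
    unfolding dyadic_piecewise_linear_def by blast
  have pos: "0 \<le> f y" if "y \<in> {0..1}" for y
    using that D(3) by force
  show ?thesis
    using x
  proof (induction "card (B \<inter> {0<..<x})" arbitrary: x rule: less_induct)
    case less
    show ?case
    proof (cases "x = 0")
      case True
      then show ?thesis using D by simp
    next
      case False
      then have x: "0 < x" "x \<le> 1" using less.prems by auto
      have "\<exists>b\<in>{0..<x}. {b<..<x} \<inter> B = {} \<and> (f b \<in> dyadics \<and> b \<in> dyadics)"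
      proof (cases "B \<inter> {0<..<x} = {}")
        case True
        have "(0::real) \<in> dyadics"
          by (subst real_dyadics_iff) auto
        then show ?thesis
          using True x D by (intro bexI[of _ 0]) auto
      next
        case False
        define b where "b = Max (B \<inter> {0<..<x})"
        have b: "b \<in> B \<inter> {0<..<x}"
          unfolding b_def using False B by (intro Max_in) auto
        have max: "y \<le> b" if "y \<in> B \<inter> {0<..<x}" for y
          unfolding b_def using that B by (intro Max_ge) auto
        have "B \<inter> {0<..<b} \<subset> B \<inter> {0<..<x}"
          using b by auto
        then have "card (B \<inter> {0<..<b}) < card (B \<inter> {0<..<x})"
          using B by (intro psubset_card_mono) auto
        then have "f b \<in> dyadics \<longleftrightarrow> b \<in> dyadics"
          using b x by (intro less.hyps) auto
        moreover have "b \<in> dyadics"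
          using b B by auto
        moreover have "{b<..<x} \<inter> B = {}"
        proof (rule equals0I)
          fix y assume "y \<in> {b<..<x} \<inter> B"
          then have "y \<in> B \<inter> {0<..<x}" "b < y"
            using b by auto
          then show False
            using max[of y] by simp
        qed
        ultimately show ?thesis
          using b by (intro bexI[of _ b]) auto
      qed
      then obtain b where b: "0 \<le> b" "b < x" "{b<..<x} \<inter> B = {}" "f b \<in> dyadics" "b \<in> dyadics"
        by auto
      then obtain k :: int and c where kc: "\<forall>y\<in>{b..x}. f y = 2 powi k * y + c"
        using lin[of b x] x by auto
      have fb: "\<exists>n::nat. f b * 2 ^ n \<in> \<int>" and bb: "\<exists>n::nat. b * 2 ^ n \<in> \<int>"
        using b pos[of b] x by (simp_all add: real_dyadics_iff)
      from bb have "\<exists>n::nat. (2 powi k * b + 0) * 2 ^ n \<in> \<int>"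
        by (intro dyadic_affine_imp) auto
      then have "\<exists>n::nat. (2 powi 0 * - (2 powi k * b) + f b) * 2 ^ n \<in> \<int>"
        using fb by (intro dyadic_affine_imp) auto
      also have "2 powi 0 * - (2 powi k * b) + f b = c"
        using kc b by simp
      finally have c: "\<exists>n::nat. c * 2 ^ n \<in> \<int>" .
      have "f x = 2 powi k * x + c"
        using kc b by simp
      then show ?thesis
        using dyadic_affine_iff[OF c, of k x] pos[of x] x by (simp add: real_dyadics_iff)
    qed
  qed
qed

lemma dyadic_piecewise_linear_restrict:
  "dyadic_piecewise_linear (restrict f {0..1}) \<longleftrightarrow> dyadic_piecewise_linear f"
proof -
  have "(\<forall>x\<in>{a..b}. restrict f {0..1} x = 2 powi k * x + c) \<longleftrightarrow>
        (\<forall>x\<in>{a..b}. f x = 2 powi k * x + c)"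
    if "0 \<le> a" "b \<le> 1" for a b c :: real and k :: int
    using that by (intro ball_cong) auto
  then show ?thesis
    unfolding dyadic_piecewise_linear_def by (simp cong: conj_cong imp_cong)
qed

lemma thompson_compose:
  assumes f: "f \<in> thompson_carrier" and g: "g \<in> thompson_carrier"
  shows "compose {0..1} f g \<in> thompson_carrier"
proof (rule thompson_carrierI)
  note F = thompson_carrierD[OF f]
  note G = thompson_carrierD[OF g]
  show "compose {0..1} f g \<in> extensional {0..1}"
    by simp
  show "bij_betw (compose {0..1} f g) {0..1} {0..1}"
    using G(2) F(2) by (rule bij_betw_compose)
  have eq: "compose {0..1} f g x = f (g x)" if "x \<in> {0..1}" for x
    using that by (simp add: compose_def)
  have "continuous_on {0..1} (\<lambda>x. f (g x))"
    using F G by (intro continuous_on_compose2[OF F(4) G(4)]) auto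
  then show "continuous_on {0..1} (compose {0..1} f g)"
    by (rule continuous_on_eq) (simp add: eq)
  have gin: "g x \<in> {0..1}" if "x \<in> {0..1}" for x
    using G(3) that by blast
  show "strict_mono_on {0..1} (compose {0..1} f g)"
  proof (rule strict_mono_onI)
    fix x y :: real
    assume xy: "x \<in> {0..1}" "y \<in> {0..1}" "x < y"
    then have "g x < g y"
      by (intro strict_mono_onD[OF G(5)])
    then have "f (g x) < f (g y)"
      using xy by (intro strict_mono_onD[OF F(5)] gin)
    then show "compose {0..1} f g x < compose {0..1} f g y"
      using xy by (simp only: eq)
  qed
  obtain B where B: "finite B" "B \<subseteq> dyadics \<inter> {0..1}"
    and linf: "\<And>a b. 0 \<le> a \<Longrightarrow> a < b \<Longrightarrow> b \<le> 1 \<Longrightarrow> {a<..<b} \<inter> B = {} \<Longrightarrow>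
       \<exists>(k::int) (c::real). \<forall>x\<in>{a..b}. f x = 2 powi k * x + c"
    using f unfolding thompson_carrier_def dyadic_piecewise_linear_def by blast
  obtain C where C: "finite C" "C \<subseteq> dyadics \<inter> {0..1}"
    and ling: "\<And>a b. 0 \<le> a \<Longrightarrow> a < b \<Longrightarrow> b \<le> 1 \<Longrightarrow> {a<..<b} \<inter> C = {} \<Longrightarrow>
       \<exists>(k::int) (c::real). \<forall>x\<in>{a..b}. g x = 2 powi k * x + c"
    using g unfolding thompson_carrier_def dyadic_piecewise_linear_def by blast
  define E where "E = C \<union> {x \<in> {0..1}. g x \<in> B}"
  have "finite (g -` B \<inter> {0..1})"
    using B G(2) by (intro finite_vimage_IntI) (auto simp: bij_betw_def)
  also have "g -` B \<inter> {0..1} = {x \<in> {0..1}. g x \<in> B}"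
    by auto
  finally have fin: "finite E"
    using C by (simp add: E_def)
  have dy: "E \<subseteq> dyadics \<inter> {0..1}"
  proof
    fix x assume "x \<in> E"
    then consider "x \<in> C" | "x \<in> {0..1}" "g x \<in> B"
      unfolding E_def by blast
    then show "x \<in> dyadics \<inter> {0..1}"
    proof cases
      case 1
      then show ?thesis using C(2) by blast
    next
      case 2
      then show ?thesis using B(2) thompson_dyadics_iff[OF g, of x] by blast
    qed
  qed
  have lin: "\<exists>(k::int) (c::real). \<forall>x\<in>{a..b}. compose {0..1} f g x = 2 powi k * x + c"
    if ab: "0 \<le> a" "a < b" "b \<le> 1" "{a<..<b} \<inter> E = {}" for a b
  proof -
    have "{a<..<b} \<inter> C = {}"
      using ab by (auto simp: E_def)
    then obtain k :: int and c where kc: "\<And>x. x \<in> {a..b} \<Longrightarrow> g x = 2 powi k * x + c"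
      using ling[of a b] ab by blast
    have gab: "g a < g b"
      using ab by (intro strict_mono_onD[OF G(5)]) auto
    have "{g a<..<g b} \<inter> B = {}"
    proof (rule equals0I)
      fix y assume y: "y \<in> {g a<..<g b} \<inter> B"
      then have "y \<in> g ` {0..1}"
        unfolding G(3) using B by auto
      then obtain x where x: "x \<in> {0..1}" "y = g x"
        by auto
      then have "a < x" "x < b"
        using y ab strict_mono_on_less[OF G(5)] by auto
      then show False
        using ab x y by (auto simp: E_def)
    qed
    then obtain l :: int and d where ld: "\<And>y. y \<in> {g a..g b} \<Longrightarrow> f y = 2 powi l * y + d"
      using linf[of "g a" "g b"] gab gin[of a] gin[of b] ab by auto
    have "compose {0..1} f g x = 2 powi (l + k) * x + (2 powi l * c + d)" if x: "x \<in> {a..b}" for x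
    proof -
      have "g x \<in> {g a..g b}"
        using x ab by (auto simp: kc)
      then have "f (g x) = 2 powi l * (2 powi k * x + c) + d"
        using ld[of "g x"] kc[OF x] by (simp only:)
      then show ?thesis
        using eq[of x] x ab by (simp add: power_int_add algebra_simps)
    qed
    then show ?thesis by blast
  qed
  show "dyadic_piecewise_linear (compose {0..1} f g)"
    unfolding dyadic_piecewise_linear_def
    using fin dy lin by blast
qed

lemma thompson_inv_into:
  assumes f: "f \<in> thompson_carrier"
  shows "restrict (inv_into {0..1} f) {0..1} \<in> thompson_carrier"
proof (rule thompson_carrierI)
  note F = thompson_carrierD[OF f]
  define h where "h = inv_into {0..1} f"
  have hin: "h y \<in> {0..1}" and fh: "f (h y) = y" if "y \<in> {0..1}" for y
    using that F(3) unfolding h_def by (blast intro: inv_into_into, metis f_inv_into_f)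
  have hf: "h (f x) = x" if "x \<in> {0..1}" for x
    using that F(2) by (simp add: h_def bij_betw_def)
  show "restrict (inv_into {0..1} f) {0..1} \<in> extensional {0..1}"
    by simp
  show "bij_betw (restrict (inv_into {0..1} f) {0..1}) {0..1} {0..1}"
    using bij_betw_inv_into[OF F(2)] by simp
  have "continuous_on (f ` {0..1}) h"
    using F hf by (intro continuous_on_inv) auto
  then show "continuous_on {0..1} (restrict (inv_into {0..1} f) {0..1})"
    unfolding F(3) by (rule continuous_on_eq) (simp add: h_def)
  have hmono: "h x < h y" if "x \<in> {0..1}" "y \<in> {0..1}" "x < y" for x y
    using strict_mono_on_less[OF F(5) hin hin, OF that(1,2)] fh that by metis
  then show "strict_mono_on {0..1} (restrict (inv_into {0..1} f) {0..1})"
    by (intro strict_mono_onI) (simp add: h_def)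
  obtain B where B: "finite B" "B \<subseteq> dyadics \<inter> {0..1}"
    and linf: "\<And>a b. 0 \<le> a \<Longrightarrow> a < b \<Longrightarrow> b \<le> 1 \<Longrightarrow> {a<..<b} \<inter> B = {} \<Longrightarrow>
       \<exists>(k::int) (c::real). \<forall>x\<in>{a..b}. f x = 2 powi k * x + c"
    using f unfolding thompson_carrier_def dyadic_piecewise_linear_def by blast
  have fin: "finite (f ` B)"
    using B by simp
  have dy: "f ` B \<subseteq> dyadics \<inter> {0..1}"
    using B thompson_dyadics_iff[OF f] F(3) by blast
  have lin: "\<exists>(k::int) (c::real). \<forall>x\<in>{a..b}. h x = 2 powi k * x + c"
    if ab: "0 \<le> a" "a < b" "b \<le> 1" "{a<..<b} \<inter> f ` B = {}" for a b
  proof -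
    have "{h a<..<h b} \<inter> B = {}"
    proof (rule equals0I)
      fix x assume x: "x \<in> {h a<..<h b} \<inter> B"
      then have x01: "x \<in> {0..1}"
        using B by auto
      have "f (h a) < f x" "f x < f (h b)"
        using x x01 hin[of a] hin[of b] ab by (auto intro!: strict_mono_onD[OF F(5)])
      then show False
        using ab x fh by auto
    qed
    then obtain k :: int and c where kc: "\<And>x. x \<in> {h a..h b} \<Longrightarrow> f x = 2 powi k * x + c"
      using linf[of "h a" "h b"] hmono[of a b] hin[of a] hin[of b] ab by auto
    have "h y = 2 powi (- k) * y + (- (2 powi (- k) * c))" if y: "y \<in> {a..b}" for y
    proof -
      have "h y \<in> {h a..h b}"
        using y ab hmono[of a y] hmono[of y b] by (cases "y = a"; cases "y = b") auto
      then have "y = 2 powi k * h y + c"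
        using kc fh[of y] y ab by auto
      then have "2 powi (- k) * y = 2 powi (- k) * (2 powi k * h y) + 2 powi (- k) * c"
        by (metis distrib_left)
      also have "2 powi (- k) * (2 powi k * h y) = h y"
        by (simp add: power_int_minus)
      finally show ?thesis by simp
    qed
    then show ?thesis by blast
  qed
  have "dyadic_piecewise_linear h"
    unfolding dyadic_piecewise_linear_def
    using fin dy lin by blast
  then show "dyadic_piecewise_linear (restrict (inv_into {0..1} f) {0..1})"
    by (simp add: dyadic_piecewise_linear_restrict h_def)
qed

lemma thompson_id: "(\<lambda>x\<in>{0..1}. x) \<in> thompson_carrier"
proof (rule thompson_carrierI)
  show "continuous_on {0..1} (\<lambda>x\<in>{0..1}. x::real)"
    by (rule continuous_on_eq[OF continuous_on_id]) simp
  have "\<forall>x\<in>{a..b}. x = 2 powi (0::int) * x + (0::real)" for a b :: real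
    by simp
  then have "dyadic_piecewise_linear (\<lambda>x. x)"
    unfolding dyadic_piecewise_linear_def by (metis empty_subsetI finite.emptyI)
  then show "dyadic_piecewise_linear (\<lambda>x\<in>{0..1}. x)"
    by (simp add: dyadic_piecewise_linear_restrict)
qed (auto simp: bij_betw_def inj_on_def strict_mono_on_def)

lemma group_thompson_group: "group thompson_group"
  unfolding thompson_group_def
proof (rule group.subgroup_imp_group[OF group_BijGroup subgroup.intro])
  have sub: "thompson_carrier \<subseteq> Bij {0..1}"
    by (auto simp: thompson_carrier_def)
  then show "thompson_carrier \<subseteq> carrier (BijGroup {0..1})"
    by (simp add: BijGroup_def)
  show "\<one>\<^bsub>BijGroup {0..1}\<^esub> \<in> thompson_carrier"
    using thompson_id by (simp add: BijGroup_def)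
  fix f assume f: "f \<in> thompson_carrier"
  then show "inv\<^bsub>BijGroup {0..1}\<^esub> f \<in> thompson_carrier"
    using sub thompson_inv_into[OF f] by (subst inv_BijGroup) auto
  fix g assume g: "g \<in> thompson_carrier"
  show "f \<otimes>\<^bsub>BijGroup {0..1}\<^esub> g \<in> thompson_carrier"
    using sub f g thompson_compose[OF f g] by (auto simp: BijGroup_def)
qed


subsection \<open>Free groups\<close>

text \<open>
  The letter \<^term>\<open>(True, x)\<close> stands for the generator \<^term>\<open>x\<close> and
  \<^term>\<open>(False, x)\<close> for its inverse. Elements of the free group are the freely reduced words.
\<close>

definition inverse_letter :: "bool \<times> 'a \<Rightarrow> bool \<times> 'a" where
  "inverse_letter l = (\<not> fst l, snd l)"

definition reduced :: "(bool \<times> 'a) list \<Rightarrow> bool" where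
  "reduced w \<longleftrightarrow> successively (\<lambda>l m. m \<noteq> inverse_letter l) w"

fun cons_letter :: "bool \<times> 'a \<Rightarrow> (bool \<times> 'a) list \<Rightarrow> (bool \<times> 'a) list" where
  "cons_letter l [] = [l]"
| "cons_letter l (m # w) = (if m = inverse_letter l then w else l # m # w)"

definition reduce_word :: "(bool \<times> 'a) list \<Rightarrow> (bool \<times> 'a) list" where
  "reduce_word w = foldr cons_letter w []"

definition free_group :: "'a set \<Rightarrow> (bool \<times> 'a) list monoid" where
  "free_group X =
     \<lparr>carrier = {w. reduced w \<and> snd ` set w \<subseteq> X},
      mult = \<lambda>u v. reduce_word (u @ v),
      one = []\<rparr>"

lemma inverse_letter_simps [simp]:
  "inverse_letter (inverse_letter l) = l" "snd (inverse_letter l) = snd l"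
  "inverse_letter l \<noteq> l" "l \<noteq> inverse_letter l"
  by (cases l; simp add: inverse_letter_def)+

lemma reduced_cons_letter: "reduced w \<Longrightarrow> reduced (cons_letter l w)"
  by (cases w) (auto simp: reduced_def successively_Cons)

lemma reduced_reduce_word: "reduced (reduce_word w)"
  unfolding reduce_word_def by (induction w) (auto simp: reduced_cons_letter, simp add: reduced_def)

lemma reduce_word_reduced: "reduced w \<Longrightarrow> reduce_word w = w"
proof (induction w)
  case (Cons l w)
  then show ?case
    by (cases w) (auto simp: reduced_def reduce_word_def)
qed (simp add: reduce_word_def)

lemma cons_letter_cancel:
  assumes "reduced w"
  shows "cons_letter l (cons_letter (inverse_letter l) w) = w"
proof (cases w)
  case (Cons m v)
  then show ?thesis
    using assms by (cases v) (auto simp: reduced_def)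
qed simp

lemma reduced_foldr: "reduced v \<Longrightarrow> reduced (foldr cons_letter u v)"
  by (induction u) (auto simp: reduced_cons_letter)

lemma foldr_cons_letter:
  assumes "reduced v"
  shows "foldr cons_letter (cons_letter l w) v = cons_letter l (foldr cons_letter w v)"
proof (cases w)
  case (Cons m w')
  then show ?thesis
    using cons_letter_cancel[OF reduced_foldr[OF assms], of l w'] by auto
qed simp

lemma foldr_reduce_word:
  assumes "reduced v"
  shows "foldr cons_letter (reduce_word u) v = foldr cons_letter u v"
  by (induction u) (use assms in \<open>auto simp: reduce_word_def foldr_cons_letter\<close>)

lemma reduce_word_append: "reduce_word (u @ v) = foldr cons_letter u (reduce_word v)"
  by (simp add: reduce_word_def)

lemma reduce_word_left: "reduce_word (reduce_word u @ v) = reduce_word (u @ v)"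
  by (simp add: reduce_word_append foldr_reduce_word reduced_reduce_word)

lemma reduce_word_right: "reduce_word (u @ reduce_word v) = reduce_word (u @ v)"
  by (simp add: reduce_word_append reduce_word_reduced reduced_reduce_word)

lemma set_reduce_word: "set (reduce_word w) \<subseteq> set w"
proof (induction w)
  case (Cons l w)
  have "set (cons_letter l v) \<subseteq> insert l (set v)" for v
    by (cases v) auto
  then show ?case
    using Cons by (fastforce simp: reduce_word_def)
qed (simp add: reduce_word_def)

lemma reduce_word_inverse: "reduce_word (rev (map inverse_letter w) @ w) = []"
proof (induction w)
  case (Cons l w)
  have "reduce_word (rev (map inverse_letter (l # w)) @ l # w)
      = foldr cons_letter (rev (map inverse_letter w))
          (cons_letter (inverse_letter l) (cons_letter l (reduce_word w)))"
    by (simp add: reduce_word_def)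
  also have "cons_letter (inverse_letter l) (cons_letter l (reduce_word w)) = reduce_word w"
    using cons_letter_cancel[OF reduced_reduce_word, of "inverse_letter l" w] by simp
  also have "foldr cons_letter (rev (map inverse_letter w)) (reduce_word w) = []"
    using Cons by (simp add: reduce_word_append)
  finally show ?case .
qed (simp add: reduce_word_def)

lemma reduced_inverse: "reduced w \<Longrightarrow> reduced (rev (map inverse_letter w))"
  unfolding reduced_def
  by (auto simp: successively_map elim!: successively_mono)

lemma group_free_group: "group (free_group X)"
proof (rule groupI)
  fix u v w
  assume u: "u \<in> carrier (free_group X)"
  then show "\<one>\<^bsub>free_group X\<^esub> \<otimes>\<^bsub>free_group X\<^esub> u = u"
    by (simp add: free_group_def reduce_word_reduced)
  have "rev (map inverse_letter u) \<in> carrier (free_group X)"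
    using u reduced_inverse[of u] by (auto simp: free_group_def)
  moreover have "rev (map inverse_letter u) \<otimes>\<^bsub>free_group X\<^esub> u = \<one>\<^bsub>free_group X\<^esub>"
    by (simp add: free_group_def reduce_word_inverse)
  ultimately show "\<exists>y\<in>carrier (free_group X). y \<otimes>\<^bsub>free_group X\<^esub> u = \<one>\<^bsub>free_group X\<^esub>"
    by blast
  assume v: "v \<in> carrier (free_group X)"
  show "u \<otimes>\<^bsub>free_group X\<^esub> v \<in> carrier (free_group X)"
    using u v set_reduce_word[of "u @ v"]
    by (fastforce simp: free_group_def reduced_reduce_word)
  show "u \<otimes>\<^bsub>free_group X\<^esub> v \<otimes>\<^bsub>free_group X\<^esub> w
      = u \<otimes>\<^bsub>free_group X\<^esub> (v \<otimes>\<^bsub>free_group X\<^esub> w)"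
    by (simp add: free_group_def reduce_word_left reduce_word_right)
qed (simp add: free_group_def reduced_def)

end

theory Submission
  imports Defs "HOL-Algebra.Elementary_Groups"
begin

text \<open>
  Both groups admit a surjective homomorphism \<open>h\<close> onto the integers: the binary logarithm of the
  slope at \<open>0\<close> for the Thompson group, and the exponent sum for a free group. Any such \<open>h\<close> yields
  the order that places \<open>x\<close> strictly below \<open>y\<close> when \<open>h x + 2 \<le> h y\<close>. It is compatible because
  a translation of \<open>G\<close> changes all values of \<open>h\<close> by one constant (\<open>compatible_threshold_order\<close>).
  It is a semiorder because it compares integers up to a fixed error, in the manner of Scott
  and Suppes (\<open>semiorder_threshold_order\<close>). It is not a weak order because the error is large
  enough to be seen: elements with values \<open>0\<close> and \<open>2\<close> form a chain, while an element of value \<open>1\<close>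
  is incomparable to both (\<open>not_weak_threshold_order\<close>).
\<close>

section \<open>Orders given by a threshold\<close>

definition threshold_order :: "'a set \<Rightarrow> ('a \<Rightarrow> int) \<Rightarrow> int \<Rightarrow> 'a rel" where
  "threshold_order A h t = {(x, y) \<in> A \<times> A. x = y \<or> h x + t \<le> h y}"

lemma threshold_order_iff:
  "(x, y) \<in> threshold_order A h t \<longleftrightarrow> x \<in> A \<and> y \<in> A \<and> (x = y \<or> h x + t \<le> h y)"
  by (auto simp: threshold_order_def)

lemma partial_order_threshold_order:
  assumes "0 < t"
  shows "partial_order_on A (threshold_order A h t)"
proof -
  have "refl_on A (threshold_order A h t)" "threshold_order A h t \<subseteq> A \<times> A"
    by (auto simp: refl_on_def threshold_order_iff threshold_order_def)
  moreover have "trans (threshold_order A h t)"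
    using assms by (intro transI) (auto simp: threshold_order_iff)
  moreover have "antisym (threshold_order A h t)"
    using assms by (intro antisymI) (auto simp: threshold_order_iff)
  ultimately show ?thesis
    by (simp add: partial_order_on_def preorder_on_def)
qed

lemma chains_simps [simp]:
  "Inl i \<in> chains_carrier r s \<longleftrightarrow> i < r" "Inr j \<in> chains_carrier r s \<longleftrightarrow> j < s"
  "(Inl i, Inl i') \<in> chains_order r s \<longleftrightarrow> i \<le> i' \<and> i' < r"
  "(Inr j, Inr j') \<in> chains_order r s \<longleftrightarrow> j \<le> j' \<and> j' < s"
  "(Inl i, Inr j) \<notin> chains_order r s" "(Inr j, Inl i) \<notin> chains_order r s"
  by (auto simp: chains_carrier_def chains_order_def)

text \<open>
  Since the embedding is injective, comparability of two distinct points is decided by \<open>h\<close> alone.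
  This reduces the exclusion of \<open>r \<oplus> s\<close> to arithmetic with the values of \<open>h\<close>.
\<close>

lemma embeds_chains_threshold_orderE:
  assumes "embeds_chains r s A (threshold_order A h t)"
  obtains u v where
    "\<And>i j. i < j \<Longrightarrow> j < r \<Longrightarrow> h (u i) + t \<le> h (u j)"
    "\<And>i j. i < j \<Longrightarrow> j < s \<Longrightarrow> h (v i) + t \<le> h (v j)"
    "\<And>i j. i < r \<Longrightarrow> j < s \<Longrightarrow> h (u i) < h (v j) + t"
    "\<And>i j. i < r \<Longrightarrow> j < s \<Longrightarrow> h (v j) < h (u i) + t"
proof -
  let ?C = "chains_carrier r s" and ?S = "chains_order r s"
  obtain f where f: "f \<in> ?C \<rightarrow> A" "inj_on f ?C"
    and iff: "\<And>x y. x \<in> ?C \<Longrightarrow> y \<in> ?C \<Longrightarrow> (f x, f y) \<in> threshold_order A h t \<longleftrightarrow> (x, y) \<in> ?S"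
    using assms by (auto simp: embeds_chains_def poset_embeds_def poset_embedding_def)
  have strict: "h (f x) + t \<le> h (f y) \<longleftrightarrow> (x, y) \<in> ?S"
    if "x \<in> ?C" "y \<in> ?C" "x \<noteq> y" for x y
    using that iff[of x y] f inj_onD[OF f(2), of x y] by (auto simp: threshold_order_iff)
  show thesis
  proof (rule that[of "f \<circ> Inl" "f \<circ> Inr"])
    show "h ((f \<circ> Inl) i) + t \<le> h ((f \<circ> Inl) j)" if "i < j" "j < r" for i j
      using that strict[of "Inl i" "Inl j"] by simp
    show "h ((f \<circ> Inr) i) + t \<le> h ((f \<circ> Inr) j)" if "i < j" "j < s" for i j
      using that strict[of "Inr i" "Inr j"] by simp
    show "h ((f \<circ> Inl) i) < h ((f \<circ> Inr) j) + t" if "i < r" "j < s" for i j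
      using that strict[of "Inr j" "Inl i"] by simp
    show "h ((f \<circ> Inr) j) < h ((f \<circ> Inl) i) + t" if "i < r" "j < s" for i j
      using that strict[of "Inl i" "Inr j"] by simp
  qed
qed

lemma semiorder_threshold_order:
  assumes "0 < t"
  shows "semiorder_on A (threshold_order A h t)"
proof -
  have "\<not> embeds_chains 2 2 A (threshold_order A h t)"
  proof
    assume "embeds_chains 2 2 A (threshold_order A h t)"
    then obtain u v :: "nat \<Rightarrow> 'a" where
      "\<And>i j. i < j \<Longrightarrow> j < 2 \<Longrightarrow> h (u i) + t \<le> h (u j)"
      "\<And>i j. i < j \<Longrightarrow> j < 2 \<Longrightarrow> h (v i) + t \<le> h (v j)"
      "\<And>i j. i < 2 \<Longrightarrow> j < 2 \<Longrightarrow> h (u i) < h (v j) + t"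
      "\<And>i j. i < 2 \<Longrightarrow> j < 2 \<Longrightarrow> h (v j) < h (u i) + t"
      by (rule embeds_chains_threshold_orderE) blast
    from this(1)[of 0 1] this(2)[of 0 1] this(3)[of 1 0] this(4)[of 0 1] show False
      by simp
  qed
  moreover have "\<not> embeds_chains 3 1 A (threshold_order A h t)"
  proof
    assume "embeds_chains 3 1 A (threshold_order A h t)"
    then obtain u v :: "nat \<Rightarrow> 'a" where
      "\<And>i j. i < j \<Longrightarrow> j < 3 \<Longrightarrow> h (u i) + t \<le> h (u j)"
      "\<And>i j. i < j \<Longrightarrow> j < 1 \<Longrightarrow> h (v i) + t \<le> h (v j)"
      "\<And>i j. i < 3 \<Longrightarrow> j < 1 \<Longrightarrow> h (u i) < h (v j) + t"
      "\<And>i j. i < 3 \<Longrightarrow> j < 1 \<Longrightarrow> h (v j) < h (u i) + t"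
      by (rule embeds_chains_threshold_orderE) blast
    \<comment> \<open>The single point lies within \<open>t\<close> of both ends of a chain that spans at least \<open>2 * t\<close>.\<close>
    from this(1)[of 0 1] this(1)[of 1 2] this(3)[of 2 0] this(4)[of 0 0] show False
      by simp
  qed
  ultimately show ?thesis
    using partial_order_threshold_order[OF assms] by (simp add: semiorder_on_def)
qed

lemma not_weak_threshold_order:
  assumes A: "x \<in> A" "y \<in> A" "z \<in> A"
    and h: "h x + t \<le> h z" "h x < h y" "h y < h z" "h y < h x + t" "h z < h y + t"
  shows "\<not> weak_order_on A (threshold_order A h t)"
proof -
  define f :: "nat + nat \<Rightarrow> 'a" where
    "f = case_sum (\<lambda>_. y) (\<lambda>j. if j = 0 then x else z)"
  have C: "chains_carrier 1 2 = {Inl 0, Inr 0, Inr 1}"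
    by (auto simp: chains_carrier_def Plus_def)
  have neq: "x \<noteq> y" "y \<noteq> z" "x \<noteq> z"
    using h by auto
  then have "poset_embedding (chains_carrier 1 2) (chains_order 1 2) A (threshold_order A h t) f"
    unfolding poset_embedding_def C using A h
    by (auto simp: f_def threshold_order_iff chains_order_def inj_on_def)
  then show ?thesis
    by (auto simp: weak_order_on_def embeds_chains_def poset_embeds_def)
qed

section \<open>Groups that map onto the integers\<close>

lemma compatible_threshold_order:
  assumes "group G" and h: "h \<in> hom G integer_group" and "0 < t"
  shows "compatible_order G (threshold_order (carrier G) h t)"
proof -
  interpret group G by fact
  have "h (x \<otimes>\<^bsub>G\<^esub> y) = h x + h y" if "x \<in> carrier G" "y \<in> carrier G" for x y
    using hom_mult[OF h that] by (simp add: integer_group_def)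
  then show ?thesis
    using partial_order_threshold_order[OF \<open>0 < t\<close>]
    by (auto simp: compatible_order_def threshold_order_iff)
qed

lemma ex_compatible_semiorder:
  assumes G: "group G" and h: "h \<in> hom G integer_group" and g: "g \<in> carrier G" "h g = 1"
  shows "\<exists>R. compatible_order G R \<and> semiorder_on (carrier G) R \<and> \<not> weak_order_on (carrier G) R"
proof -
  interpret group G by fact
  have "h \<one>\<^bsub>G\<^esub> = 0"
    using hom_one[OF h G group_integer_group] by (simp add: integer_group_def)
  moreover have "h (g \<otimes>\<^bsub>G\<^esub> g) = 2"
    using hom_mult[OF h g(1) g(1)] g by (simp add: integer_group_def)
  ultimately have "\<not> weak_order_on (carrier G) (threshold_order (carrier G) h 2)"
    using g by (intro not_weak_threshold_order[of "\<one>\<^bsub>G\<^esub>" _ g "g \<otimes>\<^bsub>G\<^esub> g"]) auto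
  then show ?thesis
    using compatible_threshold_order[OF G h, of 2] semiorder_threshold_order[of 2 "carrier G" h]
    by auto
qed

section \<open>The slope at zero of an element of the Thompson group\<close>

text \<open>
  The slope is encoded through the germ of \<open>f\<close> at \<open>0\<close>: germs of linear maps compose by multiplying
  their factors, which avoids derivatives and the chain rule.
\<close>

definition slope_exponent_at_0 :: "(real \<Rightarrow> real) \<Rightarrow> int \<Rightarrow> bool" where
  "slope_exponent_at_0 f k \<longleftrightarrow> (\<forall>\<^sub>F x in at_right 0. f x = 2 powi k * x)"

text \<open>
  To the left of the first positive breakpoint \<open>f\<close> is affine, and it has no constant term because
  \<open>f\<close> fixes \<open>0\<close>.
\<close>

lemma ex_slope_exponent_at_0:
  assumes f: "f \<in> thompson_carrier"
  shows "\<exists>k. slope_exponent_at_0 f k"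
proof -
  obtain B where B: "finite B"
    and lin: "\<And>a b. 0 \<le> a \<Longrightarrow> a < b \<Longrightarrow> b \<le> 1 \<Longrightarrow> {a<..<b} \<inter> B = {} \<Longrightarrow>
       \<exists>(k::int) (c::real). \<forall>x\<in>{a..b}. f x = 2 powi k * x + c"
    using f unfolding thompson_carrier_def dyadic_piecewise_linear_def by blast
  define b where "b = Min (insert 1 (B \<inter> {0<..}))"
  have b: "0 < b" "b \<le> 1" "{0<..<b} \<inter> B = {}"
    using B by (auto simp: b_def)
  then obtain k :: int and c where kc: "\<And>x. x \<in> {0..b} \<Longrightarrow> f x = 2 powi k * x + c"
    using lin[of 0 b] by auto
  have "c = 0"
    using kc[of 0] b thompson_carrierD(6)[OF f] by simp
  then have "slope_exponent_at_0 f k"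
    unfolding slope_exponent_at_0_def eventually_at_right_field using b kc by (intro exI[of _ b]) auto
  then show ?thesis ..
qed

lemma slope_exponent_at_0_unique:
  assumes "slope_exponent_at_0 f k" "slope_exponent_at_0 f l"
  shows "k = l"
proof -
  have "\<forall>\<^sub>F x::real in at_right 0. 0 < x"
    by (rule eventually_at_right_less)
  then have "\<forall>\<^sub>F x::real in at_right 0. (2::real) powi k = 2 powi l"
    using assms unfolding slope_exponent_at_0_def by eventually_elim auto
  then have "(2::real) powi k = 2 powi l"
    by (simp add: eventually_const)
  moreover have "(2::real) powi a < 2 powi b" if "a < b" for a b :: int
    using that by (rule power_int_strict_increasing) simp
  ultimately show ?thesis
    by (metis less_irrefl linorder_neqE)
qed

text \<open>
  Near \<open>0\<close> on the right, \<open>g\<close> is linear with positive slope, so it maps right neighbourhoods of \<open>0\<close>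
  to right neighbourhoods of \<open>0\<close>, where the germ of \<open>f\<close> applies.
\<close>

lemma slope_exponent_at_0_compose:
  assumes f: "slope_exponent_at_0 f k" and g: "slope_exponent_at_0 g l"
  shows "slope_exponent_at_0 (compose {0..1} f g) (k + l)"
proof -
  have "filterlim (\<lambda>x. 2 powi l * x) (at_right 0) (at_right (0::real))"
  proof (rule filterlim_at_withinI)
    have "((\<lambda>x. 2 powi l * x) \<longlongrightarrow> 2 powi l * 0) (at_right (0::real))"
      by (intro tendsto_intros)
    then show "((\<lambda>x. 2 powi l * x) \<longlongrightarrow> 0) (at_right (0::real))"
      by simp
    show "\<forall>\<^sub>F x::real in at_right 0. 2 powi l * x \<in> {0<..} - {0}"
      using eventually_at_right_less[of "0::real"] by eventually_elim auto
  qed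
  then have "\<forall>\<^sub>F x in at_right 0. f (2 powi l * x) = 2 powi k * (2 powi l * x)"
    using f[unfolded slope_exponent_at_0_def] by (rule eventually_compose_filterlim[rotated])
  moreover have "\<forall>\<^sub>F x::real in at_right 0. x \<in> {0<..<1}"
    by (rule eventually_at_right_real) simp
  ultimately show ?thesis
    using g unfolding slope_exponent_at_0_def
    by eventually_elim (simp add: compose_def power_int_add)
qed

definition log_slope_at_0 :: "(real \<Rightarrow> real) \<Rightarrow> int" where
  "log_slope_at_0 f = (THE k. slope_exponent_at_0 f k)"

lemma log_slope_at_0_eq: "slope_exponent_at_0 f k \<Longrightarrow> log_slope_at_0 f = k"
  unfolding log_slope_at_0_def by (blast intro: slope_exponent_at_0_unique)

lemma log_slope_at_0_hom: "log_slope_at_0 \<in> hom thompson_group integer_group"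
proof (rule homI)
  fix f g assume "f \<in> carrier thompson_group" "g \<in> carrier thompson_group"
  then have fg: "f \<in> thompson_carrier" "g \<in> thompson_carrier"
    by (auto simp: thompson_group_def)
  then obtain k l where "slope_exponent_at_0 f k" "slope_exponent_at_0 g l"
    by (blast dest: ex_slope_exponent_at_0)
  moreover from this have "slope_exponent_at_0 (compose {0..1} f g) (k + l)"
    by (rule slope_exponent_at_0_compose)
  moreover have "f \<otimes>\<^bsub>thompson_group\<^esub> g = compose {0..1} f g"
    using fg by (simp add: thompson_group_def BijGroup_def thompson_carrier_def)
  ultimately show "log_slope_at_0 (f \<otimes>\<^bsub>thompson_group\<^esub> g)
      = log_slope_at_0 f \<otimes>\<^bsub>integer_group\<^esub> log_slope_at_0 g"
    by (simp add: log_slope_at_0_eq integer_group_def)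
qed (simp add: integer_group_def)

text \<open>
  This is the inverse of the standard generator \<open>x\<^sub>0\<close> of the Thompson group, with slopes \<open>2\<close>, \<open>1\<close> and
  \<open>1 / 2\<close>. As the slopes decrease, it is the minimum of its three linear pieces, which makes continuity
  and monotonicity evident.
\<close>

definition thompson_generator :: "real \<Rightarrow> real" where
  "thompson_generator = (\<lambda>x\<in>{0..1}. min (2 * x) (min (x + 1 / 4) (x / 2 + 1 / 2)))"

lemma thompson_generator_carrier: "thompson_generator \<in> thompson_carrier"
proof (rule thompson_carrierI)
  define m where "m = (\<lambda>x::real. min (2 * x) (min (x + 1 / 4) (x / 2 + 1 / 2)))"
  have eq: "thompson_generator = restrict m {0..1}"
    by (simp add: thompson_generator_def m_def)
  have mono: "m x < m y" if "x < y" for x y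
    using that by (auto simp: m_def min_def)
  have cont: "continuous_on {0..1} m"
    unfolding m_def by (intro continuous_intros) auto
  show "thompson_generator \<in> extensional {0..1}"
    by (simp add: eq)
  show "continuous_on {0..1} thompson_generator"
    by (rule continuous_on_eq[OF cont]) (simp add: eq)
  show "strict_mono_on {0..1} thompson_generator"
    using mono by (intro strict_mono_onI) (simp add: eq)
  have "inj_on m {0..1}"
    using mono by (intro linorder_inj_onI) (auto simp: less_imp_neq)
  moreover have "m ` {0..1} = {0..1}"
  proof
    show "m ` {0..1} \<subseteq> {0..1}"
      by (auto simp: m_def min_def)
    show "{0..1} \<subseteq> m ` {0..1}"
    proof
      fix y :: real assume "y \<in> {0..1}"
      then have "\<exists>x\<ge>0. x \<le> 1 \<and> m x = y"
        using cont by (intro IVT') (auto simp: m_def min_def)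
      then show "y \<in> m ` {0..1}"
        by auto
    qed
  qed
  ultimately show "bij_betw thompson_generator {0..1} {0..1}"
    by (simp add: eq bij_betw_def inj_on_restrict_eq)
  have "\<exists>(k::int) (c::real). \<forall>x\<in>{a..b}. m x = 2 powi k * x + c"
    if ab: "a < b" and disj: "{a<..<b} \<inter> {1 / 4, 1 / 2} = {}" for a b
  proof -
    have "b \<le> 1 / 4 \<or> 1 / 4 \<le> a" "b \<le> 1 / 2 \<or> 1 / 2 \<le> a"
      using disj by force+
    then consider "b \<le> 1 / 4" | "1 / 4 \<le> a" "b \<le> 1 / 2" | "1 / 2 \<le> a"
      by linarith
    then show ?thesis
    proof cases
      case 1
      then show ?thesis
        by (intro exI[of _ 1] exI[of _ 0]) (auto simp: m_def min_def)
    next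
      case 2
      then show ?thesis
        by (intro exI[of _ 0] exI[of _ "1 / 4"]) (auto simp: m_def min_def)
    next
      case 3
      then show ?thesis
        by (intro exI[of _ "-1"] exI[of _ "1 / 2"]) (auto simp: m_def min_def power_int_minus)
    qed
  qed
  moreover have "{1 / 4, 1 / 2} \<subseteq> dyadics \<inter> {0..1::real}"
    by (auto simp: real_dyadics_iff intro: exI[of _ "1::nat"] exI[of _ "2::nat"])
  ultimately have "dyadic_piecewise_linear m"
    unfolding dyadic_piecewise_linear_def by (intro exI[of _ "{1 / 4, 1 / 2}"]) auto
  then show "dyadic_piecewise_linear thompson_generator"
    by (simp add: eq dyadic_piecewise_linear_restrict)
qed

lemma log_slope_thompson_generator: "log_slope_at_0 thompson_generator = 1"
proof (rule log_slope_at_0_eq)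
  have "\<forall>\<^sub>F x::real in at_right 0. x \<in> {0<..<1 / 4}"
    by (rule eventually_at_right_real) simp
  then show "slope_exponent_at_0 thompson_generator 1"
    unfolding slope_exponent_at_0_def
    by eventually_elim (auto simp: thompson_generator_def min_def)
qed

section \<open>The exponent sum in a free group\<close>

definition exponent_sum :: "(bool \<times> 'a) list \<Rightarrow> int" where
  "exponent_sum w = (\<Sum>l\<leftarrow>w. if fst l then 1 else -1)"

lemma exponent_sum_cons_letter: "exponent_sum (cons_letter l w) = exponent_sum (l # w)"
  by (cases w) (auto simp: exponent_sum_def inverse_letter_def)

lemma exponent_sum_reduce_word: "exponent_sum (reduce_word w) = exponent_sum w"
proof (induction w)
  case (Cons l w)
  have "exponent_sum (reduce_word (l # w)) = exponent_sum (l # reduce_word w)"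
    by (simp add: reduce_word_def exponent_sum_cons_letter)
  then show ?case
    using Cons by (simp add: exponent_sum_def)
qed (simp add: reduce_word_def)

lemma exponent_sum_hom: "exponent_sum \<in> hom (free_group X) integer_group"
  by (rule homI)
    (simp_all add: free_group_def integer_group_def exponent_sum_reduce_word,
     simp add: exponent_sum_def)

section \<open>Compatible semiorders that are not weak orders\<close>

theorem corollary14:
  shows "(\<exists>R. compatible_order thompson_group R \<and>
             semiorder_on (carrier thompson_group) R \<and>
             \<not> weak_order_on (carrier thompson_group) R) \<and>
         (\<forall>X :: 'a set. finite X \<longrightarrow> X \<noteq> {} \<longrightarrow>
            (\<exists>R. compatible_order (free_group X) R \<and>
                 semiorder_on (carrier (free_group X)) R \<and>
                 \<not> weak_order_on (carrier (free_group X)) R))"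
proof (intro conjI allI impI)
  have "thompson_generator \<in> carrier thompson_group"
    using thompson_generator_carrier by (simp add: thompson_group_def)
  then show "\<exists>R. compatible_order thompson_group R \<and>
      semiorder_on (carrier thompson_group) R \<and> \<not> weak_order_on (carrier thompson_group) R"
    using log_slope_thompson_generator
    by (rule ex_compatible_semiorder[OF group_thompson_group log_slope_at_0_hom])
next
  fix X :: "'a set"
  assume "X \<noteq> {}"
  then obtain x where "x \<in> X"
    by blast
  then have "[(True, x)] \<in> carrier (free_group X)"
    by (simp add: free_group_def reduced_def)
  moreover have "exponent_sum [(True, x)] = 1"
    by (simp add: exponent_sum_def)
  ultimately show "\<exists>R. compatible_order (free_group X) R \<and>
      semiorder_on (carrier (free_group X)) R \<and> \<not> weak_order_on (carrier (free_group X)) R"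
    by (rule ex_compatible_semiorder[OF group_free_group exponent_sum_hom])
qed

end
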